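(* The set $\mathrm{FINL}=\{e\in\mathbb N : \mathcal L_e \text{ is TxtFin-learnable}\}$, where $\mathcal L_e$ is the uniformly computably enumerable family coded by $e$, is a $\Sigma^0_3$ set (that is, it has a $\Sigma_3^0$ description).
   Context: Fix a computable pairing function $\langle\cdot,\cdot\rangle:\mathbb N^2\to\mathbb N$ and a standard numbering $W_0,W_1,\dots$ of the computably enumerable (c.e.) sets. A number $e$ codes the uniformly computably enumerable (u.c.e.) family $\mathcal L_e=\{L_0,L_1,\dots\}$ whose $i$-th member (column) is $L_i=\{x:\langle i,x\rangle\in W_e\}$; the u.c.e. families are exactly those of this form. An enumeration is a function $f:\mathbb N\to\mathbb N$; $\mathrm{content}(f)=\{x:(\exists n)\,f(n)=x\}$; $f$ is an enumeration of (for) a set $A$ if $\mathrm{content}(f)=A$. $f\upharpoonright n$ is the initial segment of $f$ of length $n$, a finite string of natural numbers. Fix a symbol $?$ (meaning that no hypothesis has been made yet). A learning machine is a (possibly partial) computable function $M$ from finite strings of natural numbers to $\mathbb N\cup\{?\}$; a statement about a value of $M$ includes that this value is defined. $M$ TxtFin-identifies an enumeration $f$ if there is $n$ such that $M(f\upharpoonright n')=\,?$ for all $n'<n$, $M(f\upharpoonright n)\neq\,?$, and $W_{M(f\upharpoonright n)}=\mathrm{content}(f)$. $M$ TxtFin-learns a c.e. set $A$ if it TxtFin-identifies every enumeration of $A$. $M$ TxtFin-learns a family of c.e. sets if it TxtFin-learns every member of the family. A family is TxtFin-learnable if some learning machine TxtFin-learns it. *)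

theory Defs
  imports Main "HOL-Library.Nat_Bijection"
begin

text \<open>
  Partial recursive functions are taken with one numeric argument; several arguments, strings
  and the like are passed through the bijections \<open>prod_encode\<close> and \<open>list_encode\<close>. The class is
  generated from zero, successor and the two projections by pairing, composition, primitive
  recursion and unbounded search (the presentation used for \<open>Nat.Partrec\<close> in Mathlib).
\<close>

datatype prog =
    Zero
  | Succ
  | Proj1
  | Proj2
  | Pairing prog prog
  | Comp prog prog
  | Primrec prog prog
  | Search prog

text \<open>
  Unbounded search diverges if some value is undefined before the first zero.
\<close>

definition minimize :: "(nat \<Rightarrow> nat option) \<Rightarrow> nat option" where
  "minimize g =
     (let P = (\<lambda>n. g n = Some 0 \<and> (\<forall>m<n. g m \<noteq> None))
      in if \<exists>n. P n then Some (LEAST n. P n) else None)"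

primrec eval_prog :: "prog \<Rightarrow> nat \<Rightarrow> nat option" where
  "eval_prog Zero x = Some 0"
| "eval_prog Succ x = Some (Suc x)"
| "eval_prog Proj1 x = Some (fst (prod_decode x))"
| "eval_prog Proj2 x = Some (snd (prod_decode x))"
| "eval_prog (Pairing p q) x =
     Option.bind (eval_prog p x)
       (\<lambda>u. Option.bind (eval_prog q x) (\<lambda>v. Some (prod_encode (u, v))))"
| "eval_prog (Comp p q) x = Option.bind (eval_prog q x) (eval_prog p)"
| "eval_prog (Primrec p q) x =
     (let (a, n) = prod_decode x
      in rec_nat (eval_prog p a)
           (\<lambda>m r. Option.bind r (\<lambda>v. eval_prog q (prod_encode (a, prod_encode (m, v))))) n)"
| "eval_prog (Search p) x = minimize (\<lambda>n. eval_prog p (prod_encode (x, n)))"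

definition partial_computable :: "(nat \<Rightarrow> nat option) \<Rightarrow> bool" where
  "partial_computable g \<longleftrightarrow> (\<exists>p. g = eval_prog p)"

definition computable_set :: "nat set \<Rightarrow> bool" where
  "computable_set A \<longleftrightarrow> partial_computable (\<lambda>x. Some (if x \<in> A then 1 else 0))"

primrec prog_encode :: "prog \<Rightarrow> nat" where
  "prog_encode Zero = 0"
| "prog_encode Succ = 1"
| "prog_encode Proj1 = 2"
| "prog_encode Proj2 = 3"
| "prog_encode (Pairing p q) = 4 * prod_encode (prog_encode p, prog_encode q) + 4"
| "prog_encode (Comp p q) = 4 * prod_encode (prog_encode p, prog_encode q) + 5"
| "prog_encode (Primrec p q) = 4 * prod_encode (prog_encode p, prog_encode q) + 6"
| "prog_encode (Search p) = 4 * prog_encode p + 7"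

lemma bij_prog_encode: "bij prog_encode"
proof (rule bijI)
  show "inj prog_encode"
  proof (rule injI)
    fix p q show "prog_encode p = prog_encode q \<Longrightarrow> p = q"
    proof (induction p arbitrary: q)
      case Zero then show ?case by (cases q) auto
    next
      case Succ then show ?case by (cases q) auto
    next
      case Proj1 then show ?case by (cases q) auto
    next
      case Proj2 then show ?case by (cases q) auto
    next
      case (Pairing p1 p2) then show ?case by (cases q) (auto, presburger+)
    next
      case (Comp p1 p2) then show ?case by (cases q) (auto, presburger+)
    next
      case (Primrec p1 p2) then show ?case by (cases q) (auto, presburger+)
    next
      case (Search p) then show ?case by (cases q) (auto, presburger+)
    qed
  qed
next
  have "\<exists>p. prog_encode p = n" for n
  proof (induction n rule: less_induct)
    case (less n)
    show ?case
    proof (cases "n < 4")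
      case True
      then have "n = 0 \<or> n = 1 \<or> n = 2 \<or> n = 3" by auto
      then show ?thesis by (metis prog_encode.simps(1-4))
    next
      case False
      define k where "k = (n - 4) div 4"
      obtain a b where ab: "k = prod_encode (a, b)" by (metis prod_decode_inverse surj_pair)
      have k: "k < n" using False by (auto simp: k_def)
      have "a \<le> k" "b \<le> k" using ab le_prod_encode_1 le_prod_encode_2 by auto
      then have "a < n" "b < n" using k by auto
      then obtain p q r where
        pqr: "prog_encode p = a" "prog_encode q = b" "prog_encode r = k"
        using less k by meson
      have "n = 4 * k + 4 \<or> n = 4 * k + 5 \<or> n = 4 * k + 6 \<or> n = 4 * k + 7"
        using False unfolding k_def by presburger
      then show ?thesis using ab pqr by (metis prog_encode.simps(5-8))
    qed
  qed
  then show "surj prog_encode" by (metis surjI)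
qed

definition prog_decode :: "nat \<Rightarrow> prog" where
  "prog_decode = inv prog_encode"

definition W :: "nat \<Rightarrow> nat set" where
  "W e = dom (eval_prog (prog_decode e))"

definition column :: "nat \<Rightarrow> nat \<Rightarrow> nat set" where
  "column e i = {x. prod_encode (i, x) \<in> W e}"

definition uce_family :: "nat \<Rightarrow> nat set set" where
  "uce_family e = range (column e)"

text \<open>
  A hypothesis is an element of \<open>\<nat> \<union> {?}\<close>. A machine is a partial function on strings, so
  \<open>M \<sigma> = None\<close> means that the value is undefined.
\<close>

datatype hypothesis = NoHyp | Hyp nat

primrec hyp_encode :: "hypothesis \<Rightarrow> nat" where
  "hyp_encode NoHyp = 0"
| "hyp_encode (Hyp h) = Suc h"

type_synonym machine = "nat list \<Rightarrow> hypothesis option"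

definition learning_machine :: "machine \<Rightarrow> bool" where
  "learning_machine M \<longleftrightarrow>
     partial_computable (\<lambda>s. map_option hyp_encode (M (list_decode s)))"

definition content :: "(nat \<Rightarrow> nat) \<Rightarrow> nat set" where
  "content f = {x. \<exists>n. f n = x}"

definition initial_segment :: "(nat \<Rightarrow> nat) \<Rightarrow> nat \<Rightarrow> nat list" where
  "initial_segment f n = map f [0..<n]"

definition TxtFin_identifies :: "machine \<Rightarrow> (nat \<Rightarrow> nat) \<Rightarrow> bool" where
  "TxtFin_identifies M f \<longleftrightarrow>
     (\<exists>n h. (\<forall>n'<n. M (initial_segment f n') = Some NoHyp) \<and>
            M (initial_segment f n) = Some (Hyp h) \<and> W h = content f)"

text \<open>
  Enumerations are total, so the empty set has none and every machine learns it.
\<close>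

definition TxtFin_learns :: "machine \<Rightarrow> nat set \<Rightarrow> bool" where
  "TxtFin_learns M A \<longleftrightarrow> (\<forall>f. content f = A \<longrightarrow> TxtFin_identifies M f)"

definition TxtFin_learns_family :: "machine \<Rightarrow> nat set set \<Rightarrow> bool" where
  "TxtFin_learns_family M F \<longleftrightarrow> (\<forall>A\<in>F. TxtFin_learns M A)"

definition TxtFin_learnable :: "nat set set \<Rightarrow> bool" where
  "TxtFin_learnable F \<longleftrightarrow> (\<exists>M. learning_machine M \<and> TxtFin_learns_family M F)"

definition FINL :: "nat set" where
  "FINL = {e. TxtFin_learnable (uce_family e)}"

text \<open>
  The arithmetical hierarchy of sets of numbers, with the computable sets at level 0.
\<close>

fun Sigma0 :: "nat \<Rightarrow> nat set \<Rightarrow> bool" and Pi0 :: "nat \<Rightarrow> nat set \<Rightarrow> bool" where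
  "Sigma0 0 A = computable_set A"
| "Sigma0 (Suc n) A = (\<exists>B. Pi0 n B \<and> A = {x. \<exists>y. prod_encode (x, y) \<in> B})"
| "Pi0 0 A = computable_set A"
| "Pi0 (Suc n) A = (\<exists>B. Sigma0 n B \<and> A = {x. \<forall>y. prod_encode (x, y) \<in> B})"

end

theory Submission
  imports Defs
begin

text \<open>
  A family is finitely learnable iff some c.e. set \<open>V\<close> of pairs (string, hypothesis) satisfies: every
  nonempty member contains the content of a string in \<open>V\<close>, and whenever a nonempty member contains
  the content of a string in \<open>V\<close>, the paired hypothesis is an index of that member. From a learner, take
  for \<open>V\<close> the strings on which it makes its first conjecture; from \<open>V\<close>, a learner waits until
  some string enumerated into \<open>V\<close> is covered by its input. Both conditions are universal statements
  about implications between \<open>\<Sigma>\<^sub>1\<close> predicates, hence \<open>\<Pi>\<^sub>2\<close>, and an index of \<open>V\<close> is quantified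
  existentially in front.
\<close>

section \<open>Computable functions and decidable predicates\<close>

abbreviation pfst :: "nat \<Rightarrow> nat" where "pfst z \<equiv> fst (prod_decode z)"
abbreviation psnd :: "nat \<Rightarrow> nat" where "psnd z \<equiv> snd (prod_decode z)"

text \<open>Restricting to total functions keeps definedness out of the closure rules.\<close>

definition computable :: "(nat \<Rightarrow> nat) \<Rightarrow> bool" where
  "computable f \<longleftrightarrow> (\<exists>p. \<forall>x. eval_prog p x = Some (f x))"

definition decidable :: "(nat \<Rightarrow> bool) \<Rightarrow> bool" where
  "decidable P \<longleftrightarrow> computable (\<lambda>x. if P x then 1 else 0)"

lemma partial_computable_Some: "partial_computable (\<lambda>x. Some (f x)) \<longleftrightarrow> computable f"
  by (auto simp: partial_computable_def computable_def fun_eq_iff eq_commute)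

lemma computable_set_iff: "computable_set A \<longleftrightarrow> decidable (\<lambda>x. x \<in> A)"
  unfolding computable_set_def decidable_def partial_computable_Some ..

named_theorems computability

lemma computable_id [computability]: "computable (\<lambda>x. x)"
proof -
  \<comment> \<open>The identity is not a basic program; pairing the two projections reassembles the
    argument.\<close>
  have "eval_prog (Pairing Proj1 Proj2) x = Some x" for x by simp
  then show ?thesis unfolding computable_def by blast
qed

lemma computable_compose: "computable f \<Longrightarrow> computable g \<Longrightarrow> computable (\<lambda>x. f (g x))"
proof -
  assume "computable f" "computable g"
  then obtain p q where "\<And>x. eval_prog p x = Some (f x)" "\<And>x. eval_prog q x = Some (g x)"
    unfolding computable_def by metis
  then have "eval_prog (Comp p q) x = Some (f (g x))" for x by simp
  then show ?thesis unfolding computable_def by blast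
qed

text \<open>Stated for a composite argument, so that introduction rules take a term apart from the
  outside. \<open>computable_compose\<close> stays out of the collection because its conclusion
  would match every term.\<close>

lemma computable_Suc [computability]: "computable f \<Longrightarrow> computable (\<lambda>x. Suc (f x))"
proof (erule computable_compose[rotated])
  show "computable Suc" unfolding computable_def by (metis eval_prog.simps(2))
qed

lemma computable_fst [computability]: "computable f \<Longrightarrow> computable (\<lambda>x. pfst (f x))"
proof (erule computable_compose[rotated])
  show "computable pfst" unfolding computable_def by (metis eval_prog.simps(3))
qed

lemma computable_snd [computability]: "computable f \<Longrightarrow> computable (\<lambda>x. psnd (f x))"
proof (erule computable_compose[rotated])
  show "computable psnd" unfolding computable_def by (metis eval_prog.simps(4))
qed

lemma computable_const [computability]: "computable (\<lambda>_. c)"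
proof (induction c)
  case 0
  then show ?case unfolding computable_def by (metis eval_prog.simps(1))
qed (rule computable_Suc)

lemma computable_pair [computability]:
  assumes "computable f" "computable g"
  shows "computable (\<lambda>x. prod_encode (f x, g x))"
proof -
  obtain p q where "\<And>x. eval_prog p x = Some (f x)" "\<And>x. eval_prog q x = Some (g x)"
    using assms unfolding computable_def by metis
  then have "eval_prog (Pairing p q) x = Some (prod_encode (f x, g x))" for x by simp
  then show ?thesis unfolding computable_def by blast
qed

lemma computable_rec_nat [computability]:
  assumes "computable f" "computable (\<lambda>z. g (pfst z) (pfst (psnd z)) (psnd (psnd z)))" "computable n"
  shows "computable (\<lambda>x. rec_nat (f x) (g x) (n x))"
proof -
  obtain p q where pq: "\<And>x. eval_prog p x = Some (f x)"
    "\<And>z. eval_prog q z = Some (g (pfst z) (pfst (psnd z)) (psnd (psnd z)))"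
    using assms(1,2) unfolding computable_def by metis
  \<comment> \<open>Both programs are total, so the bind never meets \<open>None\<close>.\<close>
  have "rec_nat (eval_prog p a)
      (\<lambda>m r. Option.bind r (\<lambda>v. eval_prog q (prod_encode (a, prod_encode (m, v))))) k
    = Some (rec_nat (f a) (g a) k)" for a k
    by (induction k) (simp_all add: pq)
  then have "eval_prog (Primrec p q) z = Some (rec_nat (f (pfst z)) (g (pfst z)) (psnd z))" for z
    by (simp add: case_prod_beta)
  then have "computable (\<lambda>z. rec_nat (f (pfst z)) (g (pfst z)) (psnd z))"
    unfolding computable_def by blast
  \<comment> \<open>\<open>Primrec\<close> reads parameter and counter from one code; here it is fed
    the pair of \<open>x\<close> and \<open>n x\<close>.\<close>
  from computable_compose[OF this computable_pair[OF computable_id assms(3)]] show ?thesis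
    by simp
qed

section \<open>Arithmetic by primitive recursion\<close>

lemma computable_add [computability]:
  assumes "computable f" "computable g" shows "computable (\<lambda>x. f x + g x)"
proof -
  have "rec_nat a (\<lambda>_ r. Suc r) n = a + n" for a n by (induction n) auto
  moreover have "computable (\<lambda>x. rec_nat (f x) (\<lambda>_ r. Suc r) (g x))"
    by (intro computability assms)
  ultimately show ?thesis by simp
qed

lemma computable_mult [computability]:
  assumes "computable f" "computable g" shows "computable (\<lambda>x. f x * g x)"
proof -
  have "rec_nat 0 (\<lambda>_ r. r + a) n = a * n" for a n :: nat by (induction n) auto
  moreover have "computable (\<lambda>x. rec_nat 0 (\<lambda>_ r. r + f x) (g x))"
    by (intro computability assms computable_compose[OF assms(1)])
  ultimately show ?thesis by simp
qed

lemma computable_diff [computability]: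
  assumes "computable f" "computable g" shows "computable (\<lambda>x. f x - g x)"
proof -
  \<comment> \<open>The predecessor is a recursion that drops the previous value and returns the
    counter. It sends 0 to 0, so iterating it gives truncated subtraction.\<close>
  have pred: "rec_nat 0 (\<lambda>m _. m) n = n - 1" for n by (cases n) auto
  have "rec_nat a (\<lambda>_ r. rec_nat 0 (\<lambda>m _. m) r) n = a - n" for a n
    by (induction n) (simp_all add: pred)
  moreover have "computable (\<lambda>x. rec_nat (f x) (\<lambda>_ r. rec_nat 0 (\<lambda>m _. m) r) (g x))"
    by (intro computability assms)
  ultimately show ?thesis by simp
qed

section \<open>Boolean and bounded-quantifier closure of decidable predicates\<close>

lemma decidable_compose: "decidable P \<Longrightarrow> computable f \<Longrightarrow> decidable (\<lambda>x. P (f x))"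
  unfolding decidable_def by (rule computable_compose)

lemma decidable_cong: "decidable P \<Longrightarrow> (\<And>x. P x \<longleftrightarrow> Q x) \<Longrightarrow> decidable Q"
proof -
  assume "decidable P" "\<And>x. P x \<longleftrightarrow> Q x"
  moreover from this have "P = Q" by blast
  ultimately show "decidable Q" by simp
qed

lemma decidable_neq_0:
  assumes "computable f" shows "decidable (\<lambda>x. f x \<noteq> 0)"
proof -
  \<comment> \<open>Truncated subtraction from 1 swaps zero and nonzero; applied twice it yields the
    0/1 value.\<close>
  have "computable (\<lambda>x. 1 - (1 - f x))" by (intro computability assms)
  moreover have "(1 - (1 - f x)) = (if f x \<noteq> 0 then 1 else 0)" for x by auto
  ultimately show ?thesis unfolding decidable_def by simp
qed

lemma decidable_less [computability]:
  "computable f \<Longrightarrow> computable g \<Longrightarrow> decidable (\<lambda>x. f x < g x)"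
  by (rule decidable_cong[OF decidable_neq_0[OF computable_diff[of g f]]]) auto

lemma decidable_not [computability]:
  assumes "decidable P" shows "decidable (\<lambda>x. \<not> P x)"
proof -
  have "decidable (\<lambda>x. 1 - (if P x then 1 else 0 :: nat) \<noteq> 0)"
    using assms unfolding decidable_def[of P] by (intro decidable_neq_0 computability)
  then show ?thesis by (rule decidable_cong) simp
qed

lemma decidable_conj [computability]:
  assumes "decidable P" "decidable Q" shows "decidable (\<lambda>x. P x \<and> Q x)"
proof -
  have "decidable (\<lambda>x. (if P x then 1 else 0) * (if Q x then 1 else 0 :: nat) \<noteq> 0)"
    using assms unfolding decidable_def[of P] decidable_def[of Q]
    by (intro decidable_neq_0 computability)
  then show ?thesis by (rule decidable_cong) simp
qed

lemma decidable_disj [computability]: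
  assumes "decidable P" "decidable Q" shows "decidable (\<lambda>x. P x \<or> Q x)"
proof -
  have "decidable (\<lambda>x. \<not> (\<not> P x \<and> \<not> Q x))" by (intro computability assms)
  then show ?thesis by simp
qed

lemma decidable_eq [computability]:
  assumes "computable f" "computable g" shows "decidable (\<lambda>x. f x = g x)"
proof -
  have "decidable (\<lambda>x. \<not> f x < g x \<and> \<not> g x < f x)" by (intro computability assms)
  then show ?thesis by (rule decidable_cong) auto
qed

lemma computable_if [computability]:
  assumes "decidable P" "computable f" "computable g"
  shows "computable (\<lambda>x. if P x then f x else g x)"
proof -
  \<comment> \<open>Recursion on the 0/1 value of \<open>P x\<close>: no step leaves
    \<open>g x\<close>, one step replaces it by \<open>f x\<close>.\<close>
  have "computable (\<lambda>x. rec_nat (g x) (\<lambda>_ _. f x) (if P x then 1 else 0))"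
    using assms(1) unfolding decidable_def
    by (intro computable_rec_nat computable_compose[OF assms(2)] computability assms)
  moreover have "rec_nat (g x) (\<lambda>_ _. f x) (if P x then 1 else 0) = (if P x then f x else g x)" for x
    by simp
  ultimately show ?thesis by simp
qed

lemma decidable_all_less [computability]:
  assumes "computable b" "decidable (\<lambda>z. P (pfst z) (psnd z))"
  shows "decidable (\<lambda>x. \<forall>y<b x. P x y)"
proof -
  have "decidable (\<lambda>z. P (pfst z) (pfst (psnd z)))"
    using decidable_compose[OF assms(2), of "\<lambda>z. prod_encode (pfst z, pfst (psnd z))"]
    by (simp add: computability)
  \<comment> \<open>The accumulator is the truth value of the conjunction over the arguments tested
    so far.\<close>
  then have "computable (\<lambda>x. rec_nat 1 (\<lambda>m r. if P x m then r else 0) (b x))"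
    by (intro computability assms)
  moreover have "rec_nat 1 (\<lambda>m r. if P x m then r else 0) n = (if \<forall>y<n. P x y then 1 else 0 :: nat)"
    for x n by (induction n) (auto simp: less_Suc_eq)
  ultimately show ?thesis unfolding decidable_def by simp
qed

lemma decidable_ex_less [computability]:
  assumes "computable b" "decidable (\<lambda>z. P (pfst z) (psnd z))"
  shows "decidable (\<lambda>x. \<exists>y<b x. P x y)"
proof -
  have "decidable (\<lambda>x. \<not> (\<forall>y<b x. \<not> P x y))" by (intro computability assms)
  then show ?thesis by simp
qed

text \<open>Minimality is restated as positivity of all earlier values, a condition that a finite
  record of values can confirm.\<close>

lemma minimize_eq_Some:
  "minimize g = Some y \<longleftrightarrow> g y = Some 0 \<and> (\<forall>m<y. \<exists>v. g m = Some (Suc v))"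
proof -
  define P where "P n \<longleftrightarrow> g n = Some 0 \<and> (\<forall>m<n. g m \<noteq> None)" for n
  have min: "minimize g = (if \<exists>n. P n then Some (LEAST n. P n) else None)"
    unfolding minimize_def P_def Let_def ..
  show ?thesis
  proof
    assume "minimize g = Some y"
    then have ex: "\<exists>n. P n" and y: "(LEAST n. P n) = y" by (auto simp: min split: if_splits)
    have "P y" using LeastI_ex[OF ex] unfolding y .
    moreover have "\<exists>v. g m = Some (Suc v)" if m: "m < y" for m
    proof -
      obtain v where v: "g m = Some v" using \<open>P y\<close> m unfolding P_def by blast
      \<comment> \<open>A value 0 at \<open>m\<close> would satisfy \<open>P\<close> before
        \<open>y\<close>, since everything below \<open>m\<close> is defined as well.\<close>
      have "\<not> P m" using not_less_Least[of m P] m unfolding y by blast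
      then have "v \<noteq> 0" using \<open>P y\<close> v m unfolding P_def by (metis less_trans)
      then show ?thesis using v not0_implies_Suc by blast
    qed
    ultimately show "g y = Some 0 \<and> (\<forall>m<y. \<exists>v. g m = Some (Suc v))"
      unfolding P_def by blast
  next
    assume r: "g y = Some 0 \<and> (\<forall>m<y. \<exists>v. g m = Some (Suc v))"
    have "P y" unfolding P_def using r by (metis option.distinct(1))
    moreover have "y \<le> n" if "P n" for n
      using r that unfolding P_def by (metis not_less nat.distinct(1) option.inject)
    ultimately have "(LEAST n. P n) = y" "\<exists>n. P n" by (auto intro: Least_equality)
    then show "minimize g = Some y" by (simp add: min)
  qed
qed

text \<open>The test is total, so the search never stalls on an undefined value and diverges only
  when there is nothing to find.\<close>

lemma partial_computable_search:
  assumes "decidable (\<lambda>z. P (pfst z) (psnd z))"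
  shows "partial_computable (\<lambda>x. if \<exists>n. P x n then Some (LEAST n. P x n) else None)"
proof -
  have "computable (\<lambda>z. if P (pfst z) (psnd z) then 0 else 1)"
    by (intro computability assms)
  then obtain p where p: "\<And>z. eval_prog p z = Some (if P (pfst z) (psnd z) then 0 else 1)"
    unfolding computable_def by metis
  have "eval_prog (Search p) x = (if \<exists>n. P x n then Some (LEAST n. P x n) else None)" for x
    by (auto simp: p minimize_def Let_def)
  then show ?thesis unfolding partial_computable_def fun_eq_iff by metis
qed

lemma computable_Least:
  assumes "decidable (\<lambda>z. P (pfst z) (psnd z))" "\<And>x. \<exists>n. P x n"
  shows "computable (\<lambda>x. LEAST n. P x n)"
  using partial_computable_search[of P] assms by (simp add: partial_computable_Some)

section \<open>Lists\<close>

text \<open>\<open>list_encode\<close> codes a cons cell as the successor of a pair and the empty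
  list as 0, so one recursion step passes to the tail.\<close>

definition code_drop :: "nat \<Rightarrow> nat \<Rightarrow> nat" where
  "code_drop c n = rec_nat c (\<lambda>_ r. psnd (r - 1)) n"

definition code_nth :: "nat \<Rightarrow> nat \<Rightarrow> nat" where
  "code_nth c n = pfst (code_drop c n - 1)"

lemma list_decode_tl: "list_decode (psnd (c - 1)) = tl (list_decode c)"
proof (cases c)
  case 0
  \<comment> \<open>At code 0 the truncated predecessor is 0 and \<open>psnd 0 = 0\<close>, so the
    tail of the empty list is again empty.\<close>
  have "prod_decode 0 = (0, 0)" by (simp add: prod_decode_def prod_decode_aux.simps)
  with 0 show ?thesis by simp
qed (simp add: case_prod_beta)

lemma list_decode_drop: "list_decode (code_drop c n) = drop n (list_decode c)"
  by (induction n) (simp_all add: code_drop_def list_decode_tl[simplified] drop_Suc tl_drop)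

lemma list_decode_eq_Nil: "list_decode c = [] \<longleftrightarrow> c = 0"
  by (metis list_decode.simps(1) list_decode_inverse)

lemma code_nth: "n < length (list_decode c) \<Longrightarrow> code_nth c n = list_decode c ! n"
proof -
  assume n: "n < length (list_decode c)"
  then have "drop n (list_decode c) \<noteq> []" by simp
  then obtain k where k: "code_drop c n = Suc k"
    by (metis list_decode_drop list_decode_eq_Nil not0_implies_Suc)
  then have "drop n (list_decode c) = pfst k # list_decode (psnd k)"
    by (simp flip: list_decode_drop add: case_prod_beta)
  then show ?thesis using n by (metis hd_drop_conv_nth list.sel(1) k code_nth_def diff_Suc_1)
qed

lemma computable_code_drop [computability]:
  "computable f \<Longrightarrow> computable g \<Longrightarrow> computable (\<lambda>x. code_drop (f x) (g x))"
  unfolding code_drop_def by (intro computability)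

lemma computable_code_nth [computability]:
  "computable f \<Longrightarrow> computable g \<Longrightarrow> computable (\<lambda>x. code_nth (f x) (g x))"
  unfolding code_nth_def by (intro computability)

text \<open>The length is the number of tails taken until code 0 is reached; the search for it
  always halts.\<close>

lemma computable_length [computability]:
  assumes "computable f" shows "computable (\<lambda>x. length (list_decode (f x)))"
proof (rule computable_compose[OF _ assms])
  have drop: "code_drop c n = 0 \<longleftrightarrow> length (list_decode c) \<le> n" for c n
    by (metis list_decode_drop list_decode_eq_Nil drop_eq_Nil)
  have "computable (\<lambda>c. LEAST n. code_drop c n = 0)"
    by (rule computable_Least, intro computability) (auto simp: drop)
  moreover have "(LEAST n. code_drop c n = 0) = length (list_decode c)" for c
    unfolding drop by (rule Least_equality) auto
  ultimately show "computable (\<lambda>c. length (list_decode c))" by simp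
qed

lemma ball_list_decode:
  "(\<forall>y\<in>set (list_decode c). P y) \<longleftrightarrow> (\<forall>n<length (list_decode c). P (code_nth c n))"
  by (auto simp: all_set_conv_all_nth code_nth)

lemma decidable_ball_list [computability]:
  assumes "computable c" "decidable (\<lambda>z. P (pfst z) (psnd z))"
  shows "decidable (\<lambda>x. \<forall>y\<in>set (list_decode (c x)). P x y)"
proof -
  have "decidable (\<lambda>z. P (pfst z) (code_nth (c (pfst z)) (psnd z)))"
    using decidable_compose[OF assms(2), of "\<lambda>z. prod_encode (pfst z, code_nth (c (pfst z)) (psnd z))"]
    by (simp add: computability computable_compose[OF assms(1)])
  then show ?thesis unfolding ball_list_decode by (intro computability assms)
qed

lemma decidable_in_list [computability]:
  assumes "computable f" "computable c"
  shows "decidable (\<lambda>x. f x \<in> set (list_decode (c x)))"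
proof -
  have "decidable (\<lambda>x. \<not> (\<forall>y\<in>set (list_decode (c x)). y \<noteq> f x))"
    by (intro computability assms computable_compose[OF assms(1)])
  then show ?thesis by (rule decidable_cong) auto
qed

section \<open>Semidecidable and \<open>\<Pi>\<^sub>2\<close> predicates\<close>

definition semidecidable :: "(nat \<Rightarrow> bool) \<Rightarrow> bool" where
  "semidecidable P \<longleftrightarrow>
     (\<exists>Q. decidable (\<lambda>z. Q (pfst z) (psnd z)) \<and> (\<forall>x. P x \<longleftrightarrow> (\<exists>y. Q x y)))"

definition pi2 :: "(nat \<Rightarrow> bool) \<Rightarrow> bool" where
  "pi2 P \<longleftrightarrow>
     (\<exists>Q. semidecidable (\<lambda>z. Q (pfst z) (psnd z)) \<and> (\<forall>x. P x \<longleftrightarrow> (\<forall>y. Q x y)))"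

section \<open>Passage to the levels of the arithmetical hierarchy\<close>

lemma semidecidable_imp_Sigma0:
  assumes "semidecidable (\<lambda>x. x \<in> A)" shows "Sigma0 (Suc 0) A"
proof -
  obtain Q where Q: "decidable (\<lambda>z. Q (pfst z) (psnd z))" "\<And>x. x \<in> A \<longleftrightarrow> (\<exists>y. Q x y)"
    using assms unfolding semidecidable_def by blast
  from Q show ?thesis
    by (auto simp: computable_set_iff intro!: exI[of _ "{z. Q (pfst z) (psnd z)}"])
qed

lemma pi2_imp_Pi0:
  assumes "pi2 (\<lambda>x. x \<in> A)" shows "Pi0 (Suc (Suc 0)) A"
proof -
  obtain Q where Q: "semidecidable (\<lambda>z. Q (pfst z) (psnd z))" "\<And>x. x \<in> A \<longleftrightarrow> (\<forall>y. Q x y)"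
    using assms unfolding pi2_def by blast
  have "Sigma0 (Suc 0) {z. Q (pfst z) (psnd z)}"
    using Q(1) by (intro semidecidable_imp_Sigma0) simp
  with Q(2) show ?thesis
    unfolding Pi0.simps(2) by (intro exI[of _ "{z. Q (pfst z) (psnd z)}"]) auto
qed

lemma Sigma0_3I:
  assumes "pi2 (\<lambda>z. P (pfst z) (psnd z))" shows "Sigma0 3 {x. \<exists>y. P x y}"
proof -
  have "Pi0 (Suc (Suc 0)) {z. P (pfst z) (psnd z)}"
    using assms by (intro pi2_imp_Pi0) simp
  then show ?thesis
    unfolding numeral_3_eq_3 Sigma0.simps(2) by (intro exI[of _ "{z. P (pfst z) (psnd z)}"]) auto
qed

text \<open>The matrix \<open>Q\<close> is handed out ready for substitution of computable
  arguments, so the closure proofs below can insert coded pairs directly.\<close>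

lemma semidecidableE:
  assumes "semidecidable P"
  obtains Q where "\<And>f g. computable f \<Longrightarrow> computable g \<Longrightarrow> decidable (\<lambda>x. Q (f x) (g x))"
    and "\<And>x. P x \<longleftrightarrow> (\<exists>y. Q x y)"
proof -
  obtain Q where Q: "decidable (\<lambda>z. Q (pfst z) (psnd z))" "\<And>x. P x \<longleftrightarrow> (\<exists>y. Q x y)"
    using assms unfolding semidecidable_def by blast
  have "decidable (\<lambda>x. Q (f x) (g x))" if "computable f" "computable g" for f g
    using decidable_compose[OF Q(1) computable_pair[OF that]] by simp
  with Q(2) that show thesis by blast
qed

lemma semidecidableI:
  "decidable (\<lambda>z. Q (pfst z) (psnd z)) \<Longrightarrow> (\<And>x. P x \<longleftrightarrow> (\<exists>y. Q x y)) \<Longrightarrow> semidecidable P"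
  unfolding semidecidable_def by blast

lemma semidecidable_compose:
  assumes "semidecidable P" "computable f" shows "semidecidable (\<lambda>x. P (f x))"
proof -
  obtain Q where Q: "\<And>f g. computable f \<Longrightarrow> computable g \<Longrightarrow> decidable (\<lambda>x. Q (f x) (g x))"
    "\<And>x. P x \<longleftrightarrow> (\<exists>y. Q x y)" using semidecidableE[OF assms(1)] by metis
  show ?thesis
    by (rule semidecidableI[of "\<lambda>x. Q (f x)"]) (intro Q computability computable_compose[OF assms(2)] | simp add: Q(2))+
qed

named_theorems semidecidability

lemma decidable_imp_semidecidable: "decidable P \<Longrightarrow> semidecidable P"
  by (rule semidecidableI[of "\<lambda>x _. P x"]) (auto intro!: decidable_compose[of P pfst] computability)

lemmas semidecidable_eq [semidecidability] = decidable_eq[THEN decidable_imp_semidecidable]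
lemmas semidecidable_in_list [semidecidability] =
  decidable_in_list[THEN decidable_imp_semidecidable]

text \<open>Two existential quantifiers merge into one over codes of pairs.\<close>

lemma semidecidable_ex [semidecidability]:
  assumes "semidecidable (\<lambda>z. P (pfst z) (psnd z))" shows "semidecidable (\<lambda>x. \<exists>y. P x y)"
proof -
  obtain Q where Q: "\<And>f g. computable f \<Longrightarrow> computable g \<Longrightarrow> decidable (\<lambda>x. Q (f x) (g x))"
    "\<And>z. P (pfst z) (psnd z) \<longleftrightarrow> (\<exists>y. Q z y)" using semidecidableE[OF assms] by metis
  have "P x y \<longleftrightarrow> (\<exists>w. Q (prod_encode (x, y)) w)" for x y using Q(2)[of "prod_encode (x, y)"] by simp
  then have "(\<exists>y. P x y) \<longleftrightarrow> (\<exists>w. Q (prod_encode (x, pfst w)) (psnd w))" for x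
    by (metis fst_conv snd_conv prod_encode_inverse)
  then show ?thesis
    by (intro semidecidableI[of "\<lambda>x w. Q (prod_encode (x, pfst w)) (psnd w)"] Q computability)
qed

lemma semidecidable_conj [semidecidability]:
  assumes "semidecidable P1" "semidecidable P2" shows "semidecidable (\<lambda>x. P1 x \<and> P2 x)"
proof -
  obtain Q1 where Q1: "\<And>f g. computable f \<Longrightarrow> computable g \<Longrightarrow> decidable (\<lambda>x. Q1 (f x) (g x))"
    "\<And>x. P1 x \<longleftrightarrow> (\<exists>y. Q1 x y)" using semidecidableE[OF assms(1)] by metis
  obtain Q2 where Q2: "\<And>f g. computable f \<Longrightarrow> computable g \<Longrightarrow> decidable (\<lambda>x. Q2 (f x) (g x))"
    "\<And>x. P2 x \<longleftrightarrow> (\<exists>y. Q2 x y)" using semidecidableE[OF assms(2)] by metis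
  have "P1 x \<and> P2 x \<longleftrightarrow> (\<exists>w. Q1 x (pfst w) \<and> Q2 x (psnd w))" for x
    unfolding Q1(2) Q2(2) by (metis fst_conv snd_conv prod_encode_inverse)
  then show ?thesis
    by (intro semidecidableI[of "\<lambda>x w. Q1 x (pfst w) \<and> Q2 x (psnd w)"] decidable_conj Q1 Q2 computability)
qed

lemma semidecidable_disj [semidecidability]:
  assumes "semidecidable P1" "semidecidable P2" shows "semidecidable (\<lambda>x. P1 x \<or> P2 x)"
proof -
  obtain Q1 where Q1: "\<And>f g. computable f \<Longrightarrow> computable g \<Longrightarrow> decidable (\<lambda>x. Q1 (f x) (g x))"
    "\<And>x. P1 x \<longleftrightarrow> (\<exists>y. Q1 x y)" using semidecidableE[OF assms(1)] by metis
  obtain Q2 where Q2: "\<And>f g. computable f \<Longrightarrow> computable g \<Longrightarrow> decidable (\<lambda>x. Q2 (f x) (g x))"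
    "\<And>x. P2 x \<longleftrightarrow> (\<exists>y. Q2 x y)" using semidecidableE[OF assms(2)] by metis
  show ?thesis
    by (intro semidecidableI[of "\<lambda>x w. Q1 x w \<or> Q2 x w"] decidable_disj Q1 Q2 computability)
      (auto simp: Q1(2) Q2(2))
qed

lemma semidecidable_all_less [semidecidability]:
  assumes "computable b" "semidecidable (\<lambda>z. P (pfst z) (psnd z))"
  shows "semidecidable (\<lambda>x. \<forall>y<b x. P x y)"
proof -
  obtain Q where Q: "\<And>f g. computable f \<Longrightarrow> computable g \<Longrightarrow> decidable (\<lambda>x. Q (f x) (g x))"
    "\<And>z. P (pfst z) (psnd z) \<longleftrightarrow> (\<exists>y. Q z y)" using semidecidableE[OF assms(2)] by metis
  have P: "P x y \<longleftrightarrow> (\<exists>w. Q (prod_encode (x, y)) w)" for x y using Q(2)[of "prod_encode (x, y)"] by simp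
  show ?thesis
  proof (rule semidecidableI[of "\<lambda>x k. \<forall>y<b x. \<exists>w<k. Q (prod_encode (x, y)) w"])
    show "decidable (\<lambda>z. \<forall>y<b (pfst z). \<exists>w<psnd z. Q (prod_encode (pfst z, y)) w)"
      by (intro decidable_all_less decidable_ex_less Q computability computable_compose[OF assms(1)])
    show "(\<forall>y<b x. P x y) \<longleftrightarrow> (\<exists>k. \<forall>y<b x. \<exists>w<k. Q (prod_encode (x, y)) w)" for x
    proof
      assume "\<forall>y<b x. P x y"
      then obtain w where w: "\<And>y. y < b x \<Longrightarrow> Q (prod_encode (x, y)) (w y)" unfolding P by metis
      \<comment> \<open>Finitely many witnesses have a common bound, here the successor of their
        sum; this bound becomes the single existential quantifier.\<close>
      have "w y < Suc (\<Sum>y<b x. w y)" if "y < b x" for y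
        using that by (simp add: le_imp_less_Suc member_le_sum)
      with w show "\<exists>k. \<forall>y<b x. \<exists>w<k. Q (prod_encode (x, y)) w" by blast
    qed (use P in blast)
  qed
qed

lemma semidecidable_ball_list [semidecidability]:
  assumes "computable c" "semidecidable (\<lambda>z. P (pfst z) (psnd z))"
  shows "semidecidable (\<lambda>x. \<forall>y\<in>set (list_decode (c x)). P x y)"
proof -
  have "semidecidable (\<lambda>z. P (pfst z) (code_nth (c (pfst z)) (psnd z)))"
    using semidecidable_compose[OF assms(2), of "\<lambda>z. prod_encode (pfst z, code_nth (c (pfst z)) (psnd z))"]
    by (simp add: computability computable_compose[OF assms(1)])
  then show ?thesis unfolding ball_list_decode by (intro semidecidability computability assms)
qed

text \<open>The existential quantifier of the premise moves out as a universal one, leaving the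
  disjunction of a decidable and a semidecidable predicate.\<close>

lemma pi2_imp [semidecidability]:
  assumes "semidecidable P1" "semidecidable P2" shows "pi2 (\<lambda>x. P1 x \<longrightarrow> P2 x)"
proof -
  obtain Q where Q: "\<And>f g. computable f \<Longrightarrow> computable g \<Longrightarrow> decidable (\<lambda>x. Q (f x) (g x))"
    "\<And>x. P1 x \<longleftrightarrow> (\<exists>y. Q x y)" using semidecidableE[OF assms(1)] by metis
  have "semidecidable (\<lambda>z. \<not> Q (pfst z) (psnd z) \<or> P2 (pfst z))"
    by (intro semidecidable_disj decidable_imp_semidecidable Q decidable_not
        semidecidable_compose[OF assms(2)] computability)
  then show ?thesis unfolding pi2_def
    by (intro exI[of _ "\<lambda>x y. \<not> Q x y \<or> P2 x"]) (auto simp: Q(2))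
qed

text \<open>Adjacent universal quantifiers merge by pairing.\<close>

lemma pi2_all [semidecidability]:
  assumes "pi2 (\<lambda>z. P (pfst z) (psnd z))" shows "pi2 (\<lambda>x. \<forall>y. P x y)"
proof -
  obtain Q where Q: "semidecidable (\<lambda>z. Q (pfst z) (psnd z))"
    "\<And>z. P (pfst z) (psnd z) \<longleftrightarrow> (\<forall>y. Q z y)" using assms unfolding pi2_def by metis
  have P: "P x y \<longleftrightarrow> (\<forall>w. Q (prod_encode (x, y)) w)" for x y using Q(2)[of "prod_encode (x, y)"] by simp
  have "semidecidable (\<lambda>z. Q (prod_encode (pfst z, pfst (psnd z))) (psnd (psnd z)))"
    using semidecidable_compose[OF Q(1),
        of "\<lambda>z. prod_encode (prod_encode (pfst z, pfst (psnd z)), psnd (psnd z))"]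
    by (simp add: computability)
  moreover have "(\<forall>y. P x y) \<longleftrightarrow> (\<forall>w. Q (prod_encode (x, pfst w)) (psnd w))" for x
    unfolding P by (metis fst_conv snd_conv prod_encode_inverse)
  ultimately show ?thesis unfolding pi2_def
    by (intro exI[of _ "\<lambda>x w. Q (prod_encode (x, pfst w)) (psnd w)"]) simp
qed

lemma pi2_conj [semidecidability]:
  assumes "pi2 P1" "pi2 P2" shows "pi2 (\<lambda>x. P1 x \<and> P2 x)"
proof -
  obtain Q1 where Q1: "semidecidable (\<lambda>z. Q1 (pfst z) (psnd z))"
    "\<And>x. P1 x \<longleftrightarrow> (\<forall>y. Q1 x y)" using assms(1) unfolding pi2_def by metis
  obtain Q2 where Q2: "semidecidable (\<lambda>z. Q2 (pfst z) (psnd z))"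
    "\<And>x. P2 x \<longleftrightarrow> (\<forall>y. Q2 x y)" using assms(2) unfolding pi2_def by metis
  show ?thesis unfolding pi2_def
    by (rule exI[of _ "\<lambda>x y. Q1 x y \<and> Q2 x y"]) (auto simp: Q1 Q2 intro: semidecidable_conj)
qed

section \<open>The evaluation relation is semidecidable\<close>

text \<open>
  A certificate is a finite set of codes of triples (program, argument, value) in which every
  triple is obtained from others by one evaluation rule. Circular justifications are impossible,
  because a rule passes to a subprogram or to a smaller recursion argument.
\<close>

abbreviation entry :: "nat \<Rightarrow> nat \<Rightarrow> nat \<Rightarrow> nat" where
  "entry e x y \<equiv> prod_encode (e, prod_encode (x, y))"

text \<open>The \<open>Search\<close> clause asks for a recorded positive value at each earlier
  argument, following \<open>minimize_eq_Some\<close>. \<open>S\<close> occurs only positively,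
  which is why certificates can be joined.\<close>

fun justified :: "nat set \<Rightarrow> prog \<Rightarrow> nat \<Rightarrow> nat \<Rightarrow> bool" where
  "justified S Zero x y \<longleftrightarrow> y = 0"
| "justified S Succ x y \<longleftrightarrow> y = Suc x"
| "justified S Proj1 x y \<longleftrightarrow> y = pfst x"
| "justified S Proj2 x y \<longleftrightarrow> y = psnd x"
| "justified S (Pairing p q) x y \<longleftrightarrow>
     (\<exists>u v. entry (prog_encode p) x u \<in> S \<and> entry (prog_encode q) x v \<in> S \<and> y = prod_encode (u, v))"
| "justified S (Comp p q) x y \<longleftrightarrow>
     (\<exists>u. entry (prog_encode q) x u \<in> S \<and> entry (prog_encode p) u y \<in> S)"
| "justified S (Primrec p q) x y \<longleftrightarrow>
     psnd x = 0 \<and> entry (prog_encode p) (pfst x) y \<in> S \<or>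
     (\<exists>m r. psnd x = Suc m \<and>
        entry (prog_encode (Primrec p q)) (prod_encode (pfst x, m)) r \<in> S \<and>
        entry (prog_encode q) (prod_encode (pfst x, prod_encode (m, r))) y \<in> S)"
| "justified S (Search p) x y \<longleftrightarrow>
     entry (prog_encode p) (prod_encode (x, y)) 0 \<in> S \<and>
     (\<forall>m<y. \<exists>v. entry (prog_encode p) (prod_encode (x, m)) (Suc v) \<in> S)"

definition certificate :: "nat set \<Rightarrow> bool" where
  "certificate S \<longleftrightarrow>
     (\<forall>t\<in>S. justified S (prog_decode (pfst t)) (pfst (psnd t)) (psnd (psnd t)))"

section \<open>Soundness and completeness of certificates\<close>

lemma prog_decode_encode [simp]: "prog_decode (prog_encode p) = p"
  unfolding prog_decode_def using bij_prog_encode by (simp add: bij_is_inj)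

lemma prog_encode_decode [simp]: "prog_encode (prog_decode e) = e"
  unfolding prog_decode_def using bij_prog_encode by (simp add: bij_is_surj surj_f_inv_f)

lemma justified_mono: "justified S p x y \<Longrightarrow> S \<subseteq> S' \<Longrightarrow> justified S' p x y"
  by (cases p) (simp_all, blast+)

lemma certificate_Un: "certificate S \<Longrightarrow> certificate S' \<Longrightarrow> certificate (S \<union> S')"
  unfolding certificate_def by (blast intro: justified_mono)

lemma certificateD:
  "certificate S \<Longrightarrow> entry (prog_encode p) x y \<in> S \<Longrightarrow> justified S p x y"
  unfolding certificate_def by (drule bspec, assumption) simp

lemma certificate_sound:
  assumes "certificate S" "entry (prog_encode p) x y \<in> S" shows "eval_prog p x = Some y"
  using assms(2)
proof (induction p arbitrary: x y)
  case (Pairing p q)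
  from certificateD[OF assms(1) Pairing.prems]
  obtain u v where "entry (prog_encode p) x u \<in> S" "entry (prog_encode q) x v \<in> S"
    "y = prod_encode (u, v)" unfolding justified.simps by blast
  with Pairing.IH show ?case by simp
next
  case (Comp p q)
  from certificateD[OF assms(1) Comp.prems]
  obtain u where "entry (prog_encode q) x u \<in> S" "entry (prog_encode p) u y \<in> S"
    unfolding justified.simps by blast
  with Comp.IH show ?case by simp
next
  case (Primrec p q)
  \<comment> \<open>The \<open>Primrec\<close> rule refers back to the same program, so the
    structural induction is supplemented by one on the recursion argument.\<close>
  have "rec_nat (eval_prog p a)
      (\<lambda>m r. Option.bind r (\<lambda>v. eval_prog q (prod_encode (a, prod_encode (m, v))))) n = Some y"
    if "entry (prog_encode (Primrec p q)) (prod_encode (a, n)) y \<in> S" for a n y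
    using that
  proof (induction n arbitrary: y)
    case 0
    from certificateD[OF assms(1) 0] have "entry (prog_encode p) a y \<in> S"
      unfolding justified.simps by simp
    then show ?case using Primrec.IH(1) by simp
  next
    case (Suc n)
    from certificateD[OF assms(1) Suc.prems]
    obtain r where "entry (prog_encode (Primrec p q)) (prod_encode (a, n)) r \<in> S"
      and "entry (prog_encode q) (prod_encode (a, prod_encode (n, r))) y \<in> S"
      unfolding justified.simps by auto
    then show ?case using Primrec.IH(2) Suc.IH[of r] by simp
  qed
  from this[of "pfst x" "psnd x" y] Primrec.prems show ?case by (simp add: case_prod_beta)
next
  case (Search p)
  from certificateD[OF assms(1) Search.prems]
  have "entry (prog_encode p) (prod_encode (x, y)) 0 \<in> S"
    "\<forall>m<y. \<exists>v. entry (prog_encode p) (prod_encode (x, m)) (Suc v) \<in> S"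
    unfolding justified.simps by blast+
  with Search.IH show ?case unfolding eval_prog.simps minimize_eq_Some by blast
qed (use certificateD[OF assms(1)] in fastforce)+

text \<open>Finiteness lets a certificate be coded by a number, as a list.\<close>

definition certified :: "nat \<Rightarrow> bool" where
  "certified t \<longleftrightarrow> (\<exists>S. finite S \<and> certificate S \<and> t \<in> S)"

lemma finite_certified:
  "finite A \<Longrightarrow> \<forall>t\<in>A. certified t \<Longrightarrow> \<exists>S. finite S \<and> certificate S \<and> A \<subseteq> S"
proof (induction A rule: finite_induct)
  case empty
  have "certificate {}" by (simp add: certificate_def)
  then show ?case by blast
next
  case (insert t A)
  obtain S where S: "finite S" "certificate S" "A \<subseteq> S" using insert by blast
  obtain S' where S': "finite S'" "certificate S'" "t \<in> S'"
    using insert.prems unfolding certified_def by blast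
  have "certificate (S \<union> S')" using S(2) S'(2) by (rule certificate_Un)
  then show ?case using S S' by (intro exI[of _ "S \<union> S'"]) blast
qed

text \<open>A certificate holding all premises of a new entry can be enlarged by it: the premises
  justify the entry, and old entries stay justified by monotonicity.\<close>

lemma certified_step:
  assumes "finite A" "\<forall>t\<in>A. certified t" "justified A p x y"
  shows "certified (entry (prog_encode p) x y)"
proof -
  obtain S where S: "finite S" "certificate S" "A \<subseteq> S"
    using finite_certified[OF assms(1,2)] by blast
  let ?S = "insert (entry (prog_encode p) x y) S"
  have "justified ?S p x y" using S(3) by (intro justified_mono[OF assms(3)]) auto
  moreover have "justified ?S p' x' y'" if "justified S p' x' y'" for p' x' y'
    using that by (rule justified_mono) auto
  ultimately have "certificate ?S"
    using S(2) unfolding certificate_def by simp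
  then show ?thesis unfolding certified_def using S(1) by (intro exI[of _ ?S]) simp
qed

text \<open>Follows the same inductions as soundness; each evaluation step names the finite set of
  entries that it uses.\<close>

lemma certificate_complete:
  "eval_prog p x = Some y \<Longrightarrow> certified (entry (prog_encode p) x y)"
proof (induction p arbitrary: x y)
  case (Pairing p q)
  then obtain u v where "eval_prog p x = Some u" "eval_prog q x = Some v" "y = prod_encode (u, v)"
    by (auto simp: bind_eq_Some_conv)
  with Pairing.IH show ?case
    by (intro certified_step[of "{entry (prog_encode p) x u, entry (prog_encode q) x v}"]) auto
next
  case (Comp p q)
  then obtain u where "eval_prog q x = Some u" "eval_prog p u = Some y"
    by (auto simp: bind_eq_Some_conv)
  with Comp.IH show ?case
    by (intro certified_step[of "{entry (prog_encode q) x u, entry (prog_encode p) u y}"]) auto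
next
  case (Primrec p q)
  have "certified (entry (prog_encode (Primrec p q)) (prod_encode (a, n)) y)"
    if "rec_nat (eval_prog p a)
      (\<lambda>m r. Option.bind r (\<lambda>v. eval_prog q (prod_encode (a, prod_encode (m, v))))) n = Some y"
    for a n y
    using that
  proof (induction n arbitrary: y)
    case 0
    with Primrec.IH(1) show ?case
      by (intro certified_step[of "{entry (prog_encode p) a y}"]) auto
  next
    case (Suc n)
    then obtain r where r: "rec_nat (eval_prog p a)
      (\<lambda>m r. Option.bind r (\<lambda>v. eval_prog q (prod_encode (a, prod_encode (m, v))))) n = Some r"
      "eval_prog q (prod_encode (a, prod_encode (n, r))) = Some y"
      by (auto simp: bind_eq_Some_conv)
    with Primrec.IH(2) Suc.IH show ?case
      by (intro certified_step[of "{entry (prog_encode (Primrec p q)) (prod_encode (a, n)) r,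
            entry (prog_encode q) (prod_encode (a, prod_encode (n, r))) y}"]) auto
  qed
  from this[of "pfst x" "psnd x" y] Primrec.prems show ?case by (simp add: case_prod_beta)
next
  case (Search p)
  then have y: "eval_prog p (prod_encode (x, y)) = Some 0"
    and "\<forall>m<y. \<exists>v. eval_prog p (prod_encode (x, m)) = Some (Suc v)"
    by (auto simp: minimize_eq_Some)
  then obtain v where "\<And>m. m < y \<Longrightarrow> eval_prog p (prod_encode (x, m)) = Some (Suc (v m))"
    by metis
  \<comment> \<open>The premises are the zero at \<open>y\<close> and one positive value for each of
    the finitely many arguments below \<open>y\<close>.\<close>
  with y Search.IH show ?case
    by (intro certified_step[of "insert (entry (prog_encode p) (prod_encode (x, y)) 0)
          ((\<lambda>m. entry (prog_encode p) (prod_encode (x, m)) (Suc (v m))) ` {..<y})"]) auto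
qed (rule certified_step[of "{}"]; simp)+

text \<open>The case distinction on syntax becomes a formula about the code \<open>e\<close>, to
  which the closure rules apply. In the recursion clause \<open>e\<close> itself stands for the code
  of the whole program.\<close>

lemma justified_decode:
  "justified S (prog_decode e) x y \<longleftrightarrow>
     e = 0 \<and> y = 0 \<or> e = 1 \<and> y = Suc x \<or> e = 2 \<and> y = pfst x \<or> e = 3 \<and> y = psnd x \<or>
     (\<exists>a b u v. e = 4 * prod_encode (a, b) + 4 \<and> entry a x u \<in> S \<and> entry b x v \<in> S \<and>
        y = prod_encode (u, v)) \<or>
     (\<exists>a b u. e = 4 * prod_encode (a, b) + 5 \<and> entry b x u \<in> S \<and> entry a u y \<in> S) \<or>
     (\<exists>a b. e = 4 * prod_encode (a, b) + 6 \<and>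
        (psnd x = 0 \<and> entry a (pfst x) y \<in> S \<or>
         (\<exists>m r. psnd x = Suc m \<and> entry e (prod_encode (pfst x, m)) r \<in> S \<and>
            entry b (prod_encode (pfst x, prod_encode (m, r))) y \<in> S))) \<or>
     (\<exists>a. e = 4 * a + 7 \<and> entry a (prod_encode (x, y)) 0 \<in> S \<and>
        (\<forall>m<y. \<exists>v. entry a (prod_encode (x, m)) (Suc v) \<in> S))"
  (is "?l \<longleftrightarrow> ?r e")
proof -
  \<comment> \<open>The codes of the four compound constructors lie in different residue classes
    modulo 4.\<close>
  have ne: "4 * a + 4 \<noteq> 4 * b + (5::nat)" "4 * a + 4 \<noteq> 4 * b + (6::nat)"
    "4 * a + 4 \<noteq> 4 * b + (7::nat)" "4 * a + 5 \<noteq> 4 * b + (6::nat)"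
    "4 * a + 5 \<noteq> 4 * b + (7::nat)" "4 * a + 6 \<noteq> 4 * b + (7::nat)" for a b
    by presburger+
  note ne = ne ne[symmetric]
  define p where "p = prog_decode e"
  have "justified S p x y \<longleftrightarrow> ?r (prog_encode p)"
    by (cases p) (simp_all add: ne)
  then show ?thesis by (simp add: p_def)
qed

lemma semidecidable_justified:
  "semidecidable (\<lambda>z. justified (set (list_decode (pfst z))) (prog_decode (pfst (psnd z)))
     (pfst (psnd (psnd z))) (psnd (psnd (psnd z))))"
  unfolding justified_decode by (intro semidecidability computability)

text \<open>Being a certificate is a bounded quantifier over a coded list, so the existence of one
  containing a given entry is semidecidable. This takes the place of a universal program.\<close>

lemma semidecidable_eval [semidecidability]:
  assumes "computable f" "computable g" "computable h"
  shows "semidecidable (\<lambda>x. eval_prog (prog_decode (f x)) (g x) = Some (h x))"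
proof -
  have "semidecidable (\<lambda>c. certificate (set (list_decode c)))"
    unfolding certificate_def
  proof (rule semidecidable_ball_list)
    show "semidecidable (\<lambda>z. justified (set (list_decode (pfst z))) (prog_decode (pfst (psnd z)))
      (pfst (psnd (psnd z))) (psnd (psnd (psnd z))))" by (rule semidecidable_justified)
  qed (rule computability)
  note certificate = semidecidable_compose[OF this]
  have "semidecidable (\<lambda>t. \<exists>c. certificate (set (list_decode c)) \<and> t \<in> set (list_decode c))"
    by (intro certificate semidecidability computability)
  moreover have "(\<exists>c. certificate (set (list_decode c)) \<and> t \<in> set (list_decode c)) \<longleftrightarrow> certified t" for t
    unfolding certified_def by (metis finite_list list_encode_inverse List.finite_set)
  ultimately have "semidecidable certified" by simp
  from semidecidable_compose[OF this, of "\<lambda>x. entry (f x) (g x) (h x)"] assms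
  have "semidecidable (\<lambda>x. certified (entry (f x) (g x) (h x)))" by (simp add: computability)
  moreover have "certified (entry e x y) \<longleftrightarrow> eval_prog (prog_decode e) x = Some y" for e x y
    by (metis certificate_complete certificate_sound certified_def prog_encode_decode)
  ultimately show ?thesis by simp
qed

section \<open>Semidecidable predicates and indices of c.e. sets\<close>

lemma semidecidable_W [semidecidability]:
  assumes "computable f" "computable g" shows "semidecidable (\<lambda>x. g x \<in> W (f x))"
  unfolding W_def dom_def mem_Collect_eq not_None_eq
  by (intro semidecidability computability computable_compose[OF assms(1)] computable_compose[OF assms(2)])

text \<open>A program searching for a witness of \<open>P x\<close> halts exactly when there is one;
  its code is the index.\<close>

lemma semidecidable_imp_W:
  assumes "semidecidable P" shows "\<exists>a. W a = {x. P x}"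
proof -
  obtain Q where Q: "decidable (\<lambda>z. Q (pfst z) (psnd z))" "\<And>x. P x \<longleftrightarrow> (\<exists>y. Q x y)"
    using assms unfolding semidecidable_def by blast
  obtain p where "eval_prog p = (\<lambda>x. if \<exists>n. Q x n then Some (LEAST n. Q x n) else None)"
    using partial_computable_search[OF Q(1)] unfolding partial_computable_def by metis
  then have "W (prog_encode p) = {x. P x}" by (auto simp: W_def Q(2) split: if_splits)
  then show ?thesis ..
qed

section \<open>Locking strings\<close>

text \<open>
  The element \<open>y\<close> excludes the empty language, which is learned vacuously. The equality of
  the member and the conjectured set is split into two inclusions so that each clause is an
  implication between semidecidable predicates.
\<close>

definition witness :: "nat \<Rightarrow> nat \<Rightarrow> bool" where
  "witness e a \<longleftrightarrow>
     (\<forall>i x. prod_encode (i, x) \<in> W e \<longrightarrow>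
        (\<exists>s h. prod_encode (s, h) \<in> W a \<and> (\<forall>y\<in>set (list_decode s). prod_encode (i, y) \<in> W e))) \<and>
     (\<forall>i s h x y. prod_encode (s, h) \<in> W a \<and> (\<forall>y\<in>set (list_decode s). prod_encode (i, y) \<in> W e) \<and>
        prod_encode (i, y) \<in> W e \<and> prod_encode (i, x) \<in> W e \<longrightarrow> x \<in> W h) \<and>
     (\<forall>i s h x y. prod_encode (s, h) \<in> W a \<and> (\<forall>y\<in>set (list_decode s). prod_encode (i, y) \<in> W e) \<and>
        prod_encode (i, y) \<in> W e \<and> x \<in> W h \<longrightarrow> prod_encode (i, x) \<in> W e)"

text \<open>Each clause is a universally quantified implication whose two sides are semidecidable,
  since quantification over the entries of a string is bounded.\<close>

lemma pi2_witness: "pi2 (\<lambda>z. witness (pfst z) (psnd z))"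
  unfolding witness_def by (intro semidecidability computability)

text \<open>The form used with learners: the elements merge into nonemptiness, the two inclusions
  into an equality, and codes are traded for strings because \<open>list_encode\<close> is
  onto.\<close>

lemma witness_alt:
  "witness e a \<longleftrightarrow>
     (\<forall>i. column e i \<noteq> {} \<longrightarrow>
        (\<exists>s h. prod_encode (list_encode s, h) \<in> W a \<and> set s \<subseteq> column e i)) \<and>
     (\<forall>i s h. column e i \<noteq> {} \<and> prod_encode (list_encode s, h) \<in> W a \<and> set s \<subseteq> column e i \<longrightarrow>
        W h = column e i)"
proof -
  have ex: "(\<exists>s. P (list_encode s)) \<longleftrightarrow> (\<exists>s. P s)"
    and all: "(\<forall>s. P (list_encode s)) \<longleftrightarrow> (\<forall>s. P s)" for P :: "nat \<Rightarrow> bool"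
    by (metis list_decode_inverse)+
  have "(\<exists>s h. prod_encode (list_encode s, h) \<in> W a \<and> set s \<subseteq> column e i) \<longleftrightarrow>
      (\<exists>s h. prod_encode (s, h) \<in> W a \<and> set (list_decode s) \<subseteq> column e i)" for i
    using ex[of "\<lambda>s. \<exists>h. prod_encode (s, h) \<in> W a \<and> set (list_decode s) \<subseteq> column e i"] by simp
  moreover have "(\<forall>s h. column e i \<noteq> {} \<and> prod_encode (list_encode s, h) \<in> W a \<and>
        set s \<subseteq> column e i \<longrightarrow> W h = column e i) \<longleftrightarrow>
      (\<forall>s h. column e i \<noteq> {} \<and> prod_encode (s, h) \<in> W a \<and>
        set (list_decode s) \<subseteq> column e i \<longrightarrow> W h = column e i)" for i
    using all[of "\<lambda>s. \<forall>h. column e i \<noteq> {} \<and> prod_encode (s, h) \<in> W a \<and>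
        set (list_decode s) \<subseteq> column e i \<longrightarrow> W h = column e i"] by simp
  moreover have "witness e a \<longleftrightarrow>
     (\<forall>i. column e i \<noteq> {} \<longrightarrow>
        (\<exists>s h. prod_encode (s, h) \<in> W a \<and> set (list_decode s) \<subseteq> column e i)) \<and>
     (\<forall>i s h. column e i \<noteq> {} \<and> prod_encode (s, h) \<in> W a \<and>
        set (list_decode s) \<subseteq> column e i \<longrightarrow> W h = column e i)"
    (is "_ \<longleftrightarrow> ?ex \<and> ?eq")
  proof -
    have mem: "prod_encode (i, x) \<in> W e \<longleftrightarrow> x \<in> column e i" for i x
      by (simp add: column_def)
    have sub: "(\<forall>x\<in>A. x \<in> B) \<longleftrightarrow> A \<subseteq> B" for A B :: "nat set" by blast
    have "(\<forall>i x. x \<in> column e i \<longrightarrow>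
        (\<exists>s h. prod_encode (s, h) \<in> W a \<and> set (list_decode s) \<subseteq> column e i)) \<longleftrightarrow> ?ex"
      by (simp only: ex_in_conv[symmetric]) blast
    moreover have "(\<forall>i s h x y. prod_encode (s, h) \<in> W a \<and> set (list_decode s) \<subseteq> column e i \<and>
          y \<in> column e i \<and> x \<in> column e i \<longrightarrow> x \<in> W h) \<and>
        (\<forall>i s h x y. prod_encode (s, h) \<in> W a \<and> set (list_decode s) \<subseteq> column e i \<and>
          y \<in> column e i \<and> x \<in> W h \<longrightarrow> x \<in> column e i) \<longleftrightarrow> ?eq"
      by (simp only: ex_in_conv[symmetric] set_eq_iff[of "W _"]) blast
    ultimately show ?thesis unfolding witness_def mem sub by simp
  qed
  ultimately show ?thesis by simp
qed

lemma initial_segment_nth: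
  "k \<le> length s \<Longrightarrow> initial_segment (\<lambda>j. if j < length s then s ! j else g j) k = take k s"
  by (rule nth_equalityI) (auto simp: initial_segment_def)

text \<open>A string with a first conjecture begins some enumeration of every nonempty member that
  contains its content. The learner is bound to that conjecture there, so it is correct for all such
  members.\<close>

lemma witness_if_learnable:
  assumes "TxtFin_learnable (uce_family e)" shows "\<exists>a. witness e a"
proof -
  obtain M where M: "learning_machine M" and "TxtFin_learns_family M (uce_family e)"
    using assms unfolding TxtFin_learnable_def by (elim exE conjE)
  then have learns: "TxtFin_identifies M f" if "content f = column e i" for i f
    using that by (simp add: TxtFin_learns_family_def TxtFin_learns_def uce_family_def)
  obtain p where "(\<lambda>s. map_option hyp_encode (M (list_decode s))) = eval_prog p"
    using M unfolding learning_machine_def partial_computable_def by (elim exE)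
  then have p: "eval_prog p s = map_option hyp_encode (M (list_decode s))" for s
    by (rule fun_cong[OF sym])
  have hyp_inj: "hyp_encode u = hyp_encode v \<longleftrightarrow> u = v" for u v
    by (cases u; cases v) auto
  have M_eq: "M (list_decode s) = Some v \<longleftrightarrow>
      eval_prog (prog_decode (prog_encode p)) s = Some (hyp_encode v)" for s v
    by (auto simp: p hyp_inj)
  \<comment> \<open>A prefix is described by a code \<open>t\<close> with the same entries instead
    of being computed; the extra existential quantifier does no harm to semidecidability.\<close>
  have take: "M (take n (list_decode s)) = Some NoHyp \<longleftrightarrow>
      (\<exists>t. length (list_decode t) = n \<and> (\<forall>k<n. code_nth t k = code_nth s k) \<and>
         eval_prog (prog_decode (prog_encode p)) t = Some 0)" if n: "n < length (list_decode s)" for n s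
  proof -
    have "length (list_decode t) = n \<and> (\<forall>k<n. code_nth t k = code_nth s k) \<longleftrightarrow>
        list_decode t = take n (list_decode s)" for t
      using n by (auto simp: list_eq_iff_nth_eq code_nth)
    moreover have "eval_prog (prog_decode (prog_encode p)) t = Some 0 \<longleftrightarrow> M (list_decode t) = Some NoHyp" for t
      using M_eq[of t NoHyp] by simp
    ultimately have "(\<exists>t. length (list_decode t) = n \<and> (\<forall>k<n. code_nth t k = code_nth s k) \<and>
         eval_prog (prog_decode (prog_encode p)) t = Some 0) \<longleftrightarrow>
        (\<exists>t. list_decode t = take n (list_decode s) \<and> M (list_decode t) = Some NoHyp)"
      by (metis (no_types, lifting))
    also have "\<dots> \<longleftrightarrow> M (take n (list_decode s)) = Some NoHyp"
      by (metis list_encode_inverse)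
    finally show ?thesis ..
  qed
  \<comment> \<open>These pairs form the set \<open>V\<close>; \<open>NoHyp\<close> on all proper
    prefixes makes the conjecture the first one on every enumeration starting with
    \<open>s\<close>.\<close>
  define first where "first s h \<longleftrightarrow> M s = Some (Hyp h) \<and> (\<forall>n<length s. M (take n s) = Some NoHyp)" for s h
  have first_decode: "first (list_decode s) h \<longleftrightarrow> eval_prog (prog_decode (prog_encode p)) s = Some (Suc h) \<and>
      (\<forall>n<length (list_decode s). \<exists>t. length (list_decode t) = n \<and>
         (\<forall>k<n. code_nth t k = code_nth s k) \<and> eval_prog (prog_decode (prog_encode p)) t = Some 0)" for s h
    unfolding first_def M_eq[of s "Hyp h"] hyp_encode.simps using take[of _ s]
    by (intro conj_cong refl all_cong) blast
  have "semidecidable (\<lambda>z. first (list_decode (pfst z)) (psnd z))"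
    unfolding first_decode by (intro semidecidability computability)
  then obtain a where a: "W a = {z. first (list_decode (pfst z)) (psnd z)}"
    using semidecidable_imp_W[of "\<lambda>z. first (list_decode (pfst z)) (psnd z)"] by blast
  have "\<exists>s h. first s h \<and> set s \<subseteq> column e i" if nonempty: "column e i \<noteq> {}" for i
  proof -
    obtain x where x: "x \<in> column e i" using nonempty by blast
    \<comment> \<open>The member in its natural order, with \<open>x\<close> filling the gaps
      because enumerations are total.\<close>
    define f where "f n = (if n \<in> column e i then n else x)" for n
    have cf: "content f = column e i" using x by (auto simp: content_def f_def)
    obtain n h where nh: "\<forall>n'<n. M (initial_segment f n') = Some NoHyp"
      "M (initial_segment f n) = Some (Hyp h)"
      using learns[OF cf] unfolding TxtFin_identifies_def by blast
    have "initial_segment f n' = take n' (initial_segment f n)" if "n' < n" for n'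
      using that by (auto simp: initial_segment_def take_map min_def)
    with nh have "first (initial_segment f n) h"
      unfolding first_def by (auto simp: initial_segment_def)
    moreover have "set (initial_segment f n) \<subseteq> column e i"
      using cf by (auto simp: initial_segment_def content_def)
    ultimately show ?thesis by blast
  qed
  moreover have "W h = column e i"
    if nonempty: "column e i \<noteq> {}" and s: "first s h" "set s \<subseteq> column e i" for i s h
  proof -
    obtain x where x: "x \<in> column e i" using nonempty by blast
    \<comment> \<open>The shift by \<open>length s\<close> lets the continuation list the whole
      member after \<open>s\<close>.\<close>
    define g where "g n = (if n - length s \<in> column e i then n - length s else x)" for n
    define f where "f n = (if n < length s then s ! n else g n)" for n
    have "f (y + length s) = y" if "y \<in> column e i" for y using that by (simp add: f_def g_def)
    moreover have "f n \<in> column e i" for n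
      using s(2) x nth_mem[of n s] by (simp add: f_def g_def subset_iff)
    ultimately have cf: "content f = column e i" unfolding content_def by fast
    obtain n h' where nh: "\<forall>n'<n. M (initial_segment f n') = Some NoHyp"
      "M (initial_segment f n) = Some (Hyp h')" "W h' = content f"
      using learns[OF cf] unfolding TxtFin_identifies_def by blast
    have seg: "initial_segment f k = take k s" if "k \<le> length s" for k
      using initial_segment_nth[OF that, of g] unfolding f_def .
    \<comment> \<open>An earlier conjecture would fall on a proper prefix of \<open>s\<close>, where
      the value is \<open>NoHyp\<close>; a later one would require \<open>NoHyp\<close> on
      \<open>s\<close> itself.\<close>
    have "n = length s"
    proof (cases n "length s" rule: linorder_cases)
      case less
      then show ?thesis using nh(2) seg[of n] s(1) by (auto simp: first_def)
    next
      case greater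
      then show ?thesis using nh(1) seg[of "length s"] s(1) by (auto simp: first_def)
    qed
    then show ?thesis using nh seg[of n] s(1) cf by (simp add: first_def)
  qed
  ultimately have "witness e a"
    unfolding witness_alt a mem_Collect_eq prod_encode_inverse fst_conv snd_conv list_encode_inverse
    by (intro conjI allI impI) (blast, metis)
  then show ?thesis ..
qed

text \<open>Rather than searching \<open>V\<close>, the machine tests on each input the single
  candidate coded by the input length, which makes it total; an enumeration passes through all
  lengths.\<close>

lemma learnable_if_witness:
  assumes "witness e a" shows "TxtFin_learnable (uce_family e)"
proof -
  have W: "semidecidable (\<lambda>z. z \<in> W a)" by (intro semidecidability computability)
  obtain Q where Q: "\<And>f g. computable f \<Longrightarrow> computable g \<Longrightarrow> decidable (\<lambda>x. Q (f x) (g x))"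
    and W_a: "\<And>z. z \<in> W a \<longleftrightarrow> (\<exists>c. Q z c)" using semidecidableE[OF W] by metis
  \<comment> \<open>The length of the input is read as a code \<open>\<langle>\<langle>s, h\<rangle>, \<langle>c, k\<rangle>\<rangle>\<close>; the padding \<open>k\<close> makes every
    triple \<open>s, h, c\<close> come up after arbitrarily long inputs.\<close>
  define ok where "ok t n \<longleftrightarrow> Q (pfst n) (pfst (psnd n)) \<and>
    (\<forall>x\<in>set (list_decode (pfst (pfst n))). x \<in> set (list_decode t))" for t n
  \<comment> \<open>Later inputs may produce other hypotheses; identification looks only at the
    first conjecture.\<close>
  define M :: machine where "M s = Some (if ok (list_encode s) (length s)
    then Hyp (psnd (pfst (length s))) else NoHyp)" for s
  have "decidable (\<lambda>t. ok t (length (list_decode t)))"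
    unfolding ok_def by (intro decidable_conj Q computability)
  then have "computable (\<lambda>t. if ok t (length (list_decode t))
      then Suc (psnd (pfst (length (list_decode t)))) else 0)"
    by (intro computability)
  moreover have "map_option hyp_encode (M (list_decode t)) = Some (if ok t (length (list_decode t))
      then Suc (psnd (pfst (length (list_decode t)))) else 0)" for t
    by (simp add: M_def)
  ultimately have "learning_machine M"
    unfolding learning_machine_def by (simp only: partial_computable_Some)
  moreover have "TxtFin_identifies M f" if f: "content f = column e i" for f i
  proof -
    have nonempty: "column e i \<noteq> {}" using f by (auto simp: content_def)
    then obtain s h where sh: "prod_encode (list_encode s, h) \<in> W a" "set s \<subseteq> column e i"
      using assms unfolding witness_alt by metis
    then obtain c where c: "Q (prod_encode (list_encode s, h)) c" unfolding W_a by blast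
    have "\<forall>x\<in>set s. \<exists>n. f n = x" using sh(2) f unfolding content_def by blast
    then obtain pos where pos: "\<And>x. x \<in> set s \<Longrightarrow> f (pos x) = x" by metis
    \<comment> \<open>\<open>k\<close> exceeds a position in \<open>f\<close> of every element of
      \<open>s\<close>. As \<open>k\<close> is a component of the code \<open>N\<close>, also
      \<open>k \<le> N\<close>, so all of \<open>s\<close> has appeared in the first
      \<open>N\<close> values.\<close>
    define k where "k = Suc (\<Sum>x\<in>set s. pos x)"
    define N where "N = prod_encode (prod_encode (list_encode s, h), prod_encode (c, k))"
    have "k \<le> N" unfolding N_def using le_prod_encode_2 le_trans by blast
    moreover have "pos x < k" if "x \<in> set s" for x
      using that by (simp add: k_def le_imp_less_Suc member_le_sum)
    ultimately have "x \<in> f ` {..<N}" if "x \<in> set s" for x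
      using that pos[of x] by (metis image_eqI lessThan_iff less_le_trans)
    then have "M (initial_segment f N) = Some (Hyp h)"
      using c by (auto simp: M_def ok_def initial_segment_def N_def atLeast0LessThan)
    then have ex: "\<exists>n. M (initial_segment f n) \<noteq> Some NoHyp" by (metis hypothesis.distinct(1) option.inject)
    \<comment> \<open>The first conjecture may come before \<open>N\<close> and from a different
      pair; the second clause of \<open>witness_alt\<close> makes it correct all the same.\<close>
    define n where "n = (LEAST n. M (initial_segment f n) \<noteq> Some NoHyp)"
    have "\<forall>n'<n. M (initial_segment f n') = Some NoHyp"
      unfolding n_def using not_less_Least by blast
    moreover have "M (initial_segment f n) \<noteq> Some NoHyp"
      unfolding n_def using LeastI_ex[OF ex] .
    then have "ok (list_encode (initial_segment f n)) n"
      and hyp: "M (initial_segment f n) = Some (Hyp (psnd (pfst n)))"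
      by (auto simp: M_def initial_segment_def split: if_splits)
    then have "pfst n \<in> W a" "set (list_decode (pfst (pfst n))) \<subseteq> column e i"
      by (auto simp: ok_def W_a initial_segment_def content_def simp flip: f)
    then have "W (psnd (pfst n)) = column e i"
      using assms nonempty unfolding witness_alt
      by (metis list_decode_inverse prod.collapse prod_decode_inverse)
    ultimately show ?thesis unfolding TxtFin_identifies_def using f hyp by metis
  qed
  then have "TxtFin_learns_family M (uce_family e)"
    by (simp add: TxtFin_learns_family_def TxtFin_learns_def uce_family_def)
  ultimately show ?thesis unfolding TxtFin_learnable_def by (intro exI conjI)
qed

theorem theorem2p1: "Sigma0 3 FINL"
proof -
  have "FINL = {e. \<exists>a. witness e a}"
    unfolding FINL_def using witness_if_learnable learnable_if_witness by blast
  then show ?thesis using Sigma0_3I[OF pi2_witness] by simp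
qed

end
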